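(* Let $p,q\in\mathbb{N}$. If $\mathbb{X}\subset\mathbb{R}^p$ is a compact set, then the sets $\mathcal{M}_q^{*}(\mathbb{X})$ and $\mathcal{M}_q(\mathbb{X})$ of multiple-output mixture of linear experts mean functions are both dense in $\mathcal{C}_q(\mathbb{X})$ with respect to the norm $\|\cdot\|_{q,\infty}$; that is, for every $\boldsymbol{v}\in\mathcal{C}_q(\mathbb{X})$ and every $\epsilon>0$ there exists $\boldsymbol{m}\in\mathcal{M}_q^{*}(\mathbb{X})$ with $\|\boldsymbol{m}-\boldsymbol{v}\|_{q,\infty}<\epsilon$, and likewise with $\mathcal{M}_q(\mathbb{X})$ in place of $\mathcal{M}_q^{*}(\mathbb{X})$.
   Context: For $\boldsymbol{\mu}\in\mathbb{R}^p$ and symmetric positive-definite $\boldsymbol{\Sigma}\in\mathbb{R}^{p\times p}$, $\phi_p(\boldsymbol{x};\boldsymbol{\mu},\boldsymbol{\Sigma})=|2\pi\boldsymbol{\Sigma}|^{-1/2}\exp[-\tfrac12(\boldsymbol{x}-\boldsymbol{\mu})^\top\boldsymbol{\Sigma}^{-1}(\boldsymbol{x}-\boldsymbol{\mu})]$ is the Gaussian density. $\mathcal{M}_q(\mathbb{X})$ is the class of all functions $\boldsymbol{m}:\mathbb{X}\to\mathbb{R}^q$ of the form \[ \boldsymbol{m}(\boldsymbol{x};\boldsymbol{\theta})=\sum_{z=1}^n\frac{\pi_z\,\phi_p(\boldsymbol{x};\boldsymbol{\mu}_z,\boldsymbol{\Sigma}_z)}{\sum_{\zeta=1}^n\pi_\zeta\,\phi_p(\boldsymbol{x};\boldsymbol{\mu}_\zeta,\boldsymbol{\Sigma}_\zeta)}\left[\boldsymbol{a}_z+\mathbf{B}_z^\top\boldsymbol{x}\right],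 \] where $n\in\mathbb{N}$ (positive integers), $\pi_z>0$ with $\sum_{z=1}^n\pi_z=1$, $\boldsymbol{\mu}_z\in\mathbb{R}^p$, $\boldsymbol{\Sigma}_z\in\mathbb{R}^{p\times p}$ symmetric positive-definite, $\boldsymbol{a}_z\in\mathbb{R}^q$, $\mathbf{B}_z\in\mathbb{R}^{p\times q}$, for $z\in\{1,\dots,n\}$. $\mathcal{M}_q^{*}(\mathbb{X})\subset\mathcal{M}_q(\mathbb{X})$ is the subclass in which $\mathbf{B}_z=\mathbf{0}$ for every $z$. $\mathcal{C}_q(\mathbb{X})$ is the space of functions $\boldsymbol{m}=(m_1,\dots,m_q)^\top$ on $\mathbb{X}$ whose coordinates $m_j:\mathbb{X}\to\mathbb{R}$ are all continuous. For $\boldsymbol{u}=(u_1,\dots,u_q)^\top$ on $\mathbb{X}$, $\|\boldsymbol{u}\|_{q,\infty}=\sum_{j=1}^q\|u_j\|_\infty$, where $\|u_j\|_\infty=\sup_{\boldsymbol{x}\in\mathbb{X}}|u_j(\boldsymbol{x})|$. *)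

theory Defs
  imports "HOL-Analysis.Analysis"
begin

definition sym_pos_def :: "real^'p^'p \<Rightarrow> bool" where
  "sym_pos_def S \<longleftrightarrow> transpose S = S \<and> (\<forall>x. x \<noteq> 0 \<longrightarrow> x \<bullet> (S *v x) > 0)"

definition gauss_density :: "real^'p \<Rightarrow> real^'p \<Rightarrow> real^'p^'p \<Rightarrow> real" where
  "gauss_density x \<mu> S =
     det ((2 * pi) *\<^sub>R S) powr (- 1 / 2) *
     exp (- (1 / 2) * ((x - \<mu>) \<bullet> (matrix_inv S *v (x - \<mu>))))"

(* The family of n experts is indexed by {1..n}; values of the parameter
   functions outside this range are irrelevant.  A p x q matrix B has type
   real^'q^'p (rows indexed by 'p). *)
definition moe_mean ::
  "nat \<Rightarrow> (nat \<Rightarrow> real) \<Rightarrow> (nat \<Rightarrow> real^'p) \<Rightarrow> (nat \<Rightarrow> real^'p^'p) \<Rightarrow>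
   (nat \<Rightarrow> real^'q) \<Rightarrow> (nat \<Rightarrow> real^'q^'p) \<Rightarrow> real^'p \<Rightarrow> real^'q" where
  "moe_mean n w \<mu> S a B x =
     (\<Sum>z=1..n.
        (w z * gauss_density x (\<mu> z) (S z) /
           (\<Sum>\<zeta>=1..n. w \<zeta> * gauss_density x (\<mu> \<zeta>) (S \<zeta>)))
        *\<^sub>R (a z + transpose (B z) *v x))"

definition gate_params :: "nat \<Rightarrow> (nat \<Rightarrow> real) \<Rightarrow> (nat \<Rightarrow> real^'p^'p) \<Rightarrow> bool" where
  "gate_params n w S \<longleftrightarrow>
     n \<ge> 1 \<and> (\<forall>z\<in>{1..n}. w z > 0) \<and> (\<Sum>z=1..n. w z) = 1 \<and>
     (\<forall>z\<in>{1..n}. sym_pos_def (S z))"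

(* Functions on X are represented by total functions of which only the values
   on X matter; hence membership in the classes below constrains m on X only. *)
definition MoE :: "(real^'p) set \<Rightarrow> (real^'p \<Rightarrow> real^'q) set" where
  "MoE X = {m. \<exists>n w \<mu> S a B. gate_params n w S \<and>
                 (\<forall>x\<in>X. m x = moe_mean n w \<mu> S a B x)}"

definition MoE_star :: "(real^'p) set \<Rightarrow> (real^'p \<Rightarrow> real^'q) set" where
  "MoE_star X = {m. \<exists>n w \<mu> S a B. gate_params n w S \<and> (\<forall>z\<in>{1..n}. B z = 0) \<and>
                      (\<forall>x\<in>X. m x = moe_mean n w \<mu> S a B x)}"

definition Cq :: "(real^'p) set \<Rightarrow> (real^'p \<Rightarrow> real^'q) set" where
  "Cq X = {v. \<forall>j. continuous_on X (\<lambda>x. v x $ j)}"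

(* Valued in ennreal so that the suprema are the true ones: 0 if X is empty,
   infinite if a coordinate is unbounded (Sup on real is unspecified there). *)
definition sup_norm :: "(real^'p) set \<Rightarrow> (real^'p \<Rightarrow> real^'q) \<Rightarrow> ennreal" where
  "sup_norm X u = (\<Sum>j\<in>UNIV. SUP x\<in>X. ennreal \<bar>u x $ j\<bar>)"

end

(* Take a finite fine net of X as the gate centres, equal weights, a common covariance s I, and
   let the expert at a centre be constantly the value of v there. The common Gaussian prefactor
   cancels, so the mean function is a softmax average of values of v; as s tends to 0 the softmax
   concentrates on centres near x, and uniform continuity of v finishes. *)

theory Submission
  imports Defs
begin

text \<open>The weights at \<open>x\<close> sum to 1, so the error is a weighted average of the
  differences \<open>v (c z) - v x\<close>. Centres within \<open>d\<close> of \<open>x\<close>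
  contribute little by uniform continuity, the others because their weights are exponentially small.
  Only distances enter, hence the setting of a general metric space.\<close>

lemma softmax_gaussian_approximation:
  fixes v :: "'a::metric_space \<Rightarrow> 'b::real_normed_vector"
  assumes "compact X" "X \<noteq> {}" "continuous_on X v" "0 < \<eta>"
  obtains n :: nat and s :: real and c :: "nat \<Rightarrow> 'a"
  where "1 \<le> n" "0 < s"
    "\<forall>x\<in>X.
       norm ((\<Sum>z=1..n. (exp (- (dist x (c z))\<^sup>2 / (2 * s)) /
                         (\<Sum>\<zeta>=1..n. exp (- (dist x (c \<zeta>))\<^sup>2 / (2 * s)))) *\<^sub>R v (c z)) - v x) < \<eta>"
proof -
  have "uniformly_continuous_on X v"
    using assms by (simp add: compact_uniformly_continuous)
  then obtain d where "0 < d"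
    and d: "\<And>x y. x \<in> X \<Longrightarrow> y \<in> X \<Longrightarrow> dist y x < d \<Longrightarrow> dist (v y) (v x) < \<eta> / 2"
    unfolding uniformly_continuous_on_def using \<open>0 < \<eta>\<close> by (meson half_gt_zero)
  have "bounded (v ` X)"
    using assms by (simp add: compact_continuous_image compact_imp_bounded)
  then obtain M where "0 < M" and M: "\<And>x. x \<in> X \<Longrightarrow> norm (v x) \<le> M"
    by (auto simp: bounded_pos)
  \<comment> \<open>Radius \<open>d / 2\<close> instead of \<open>d\<close> leaves a gap between the
    nearest centre and any centre at distance at least \<open>d\<close>; this gap drives the
    exponential decay.\<close>
  have "X \<subseteq> (\<Union>k\<in>X. ball k (d / 2))"
    using \<open>0 < d\<close> by force
  then obtain K where "finite K" "K \<subseteq> X" and K: "X \<subseteq> (\<Union>k\<in>K. ball k (d / 2))"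
    by (rule compactE_image[OF \<open>compact X\<close> open_ball])
  have "K \<noteq> {}" using K \<open>X \<noteq> {}\<close> by auto
  define n where "n = card K"
  have "1 \<le> n"
    using \<open>finite K\<close> \<open>K \<noteq> {}\<close> by (simp add: n_def Suc_le_eq card_gt_0_iff)
  obtain c where "bij_betw c {1..n} K"
    using ex_bij_betw_nat_finite_1[OF \<open>finite K\<close>] n_def by blast
  then have cK: "c ` {1..n} = K" by (simp add: bij_betw_def)
  \<comment> \<open>Up to \<open>n\<close> far centres may each contribute
    \<open>exp (- r) * (2 * M)\<close>. Since \<open>exp (- r) < 1 / r\<close>, this
    \<open>r\<close> keeps their total below \<open>\<eta> / 2\<close>. It depends on
    \<open>n\<close>, so the net is fixed before the variance.\<close>
  define r where "r = 4 * n * M / \<eta>"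
  have "0 < r" using \<open>1 \<le> n\<close> \<open>0 < M\<close> \<open>0 < \<eta>\<close> by (simp add: r_def)
  have "r < exp r"
    using exp_ge_add_one_self[of r] by linarith
  then have "exp (- r) < 1 / r"
    using \<open>0 < r\<close> by (simp add: exp_minus divide_simps)
  then have "exp (- r) * (2 * n * M) < 1 / r * (2 * n * M)"
    using \<open>1 \<le> n\<close> \<open>0 < M\<close> by (intro mult_strict_right_mono) auto
  also have "\<dots> = \<eta> / 2"
    using \<open>1 \<le> n\<close> \<open>0 < M\<close> \<open>0 < \<eta>\<close> by (simp add: r_def field_simps)
  finally have r: "exp (- r) * (2 * n * M) < \<eta> / 2" .
  \<comment> \<open>Every point has a centre within \<open>d / 2\<close>, so a centre further than \<open>d\<close> away gets gating
      weight at most \<open>exp (- (d\<^sup>2 - (d / 2)\<^sup>2) / (2 * s)) = exp (- r)\<close>.\<close>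
  define s where "s = 3 * d\<^sup>2 / (8 * r)"
  have "0 < s" using \<open>0 < d\<close> \<open>0 < r\<close> by (simp add: s_def)
  show ?thesis
  proof (rule that[OF \<open>1 \<le> n\<close> \<open>0 < s\<close>, of c], rule ballI)
    fix x assume x: "x \<in> X"
    define e where "e z = exp (- (dist x (c z))\<^sup>2 / (2 * s))" for z
    define T where "T = (\<Sum>z=1..n. e z)"
    have e0: "0 < e z" for z by (simp add: e_def)
    have "0 < T" unfolding T_def using \<open>1 \<le> n\<close> by (intro sum_pos e0) auto
    have one: "(\<Sum>z=1..n. e z / T) = 1"
      using \<open>0 < T\<close> by (simp add: T_def flip: sum_divide_distrib)
    obtain z0 where z0: "z0 \<in> {1..n}" "dist x (c z0) < d / 2"
      using K x cK by (force simp: dist_commute)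
    \<comment> \<open>Adding the near and the far estimate gives one bound valid for every centre,
      so the sum need not be split according to \<open>x\<close>.\<close>
    have bound: "norm ((e z / T) *\<^sub>R (v (c z) - v x)) \<le> e z / T * (\<eta> / 2) + exp (- r) * (2 * M)"
      if z: "z \<in> {1..n}" for z
    proof -
      have cz: "c z \<in> X" using z cK \<open>K \<subseteq> X\<close> by blast
      have pos: "0 < e z / T" using e0 \<open>0 < T\<close> by simp
      then have norm_eq: "norm ((e z / T) *\<^sub>R (v (c z) - v x)) = e z / T * norm (v (c z) - v x)"
        by (simp only: norm_scaleR abs_of_pos)
      show ?thesis
      proof (cases "dist (c z) x < d")
        case True
        then have "norm (v (c z) - v x) \<le> \<eta> / 2"
          using d[OF x cz] by (simp add: dist_norm)
        then have "e z / T * norm (v (c z) - v x) \<le> e z / T * (\<eta> / 2)"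
          using pos by (intro mult_left_mono) auto
        then show ?thesis
          unfolding norm_eq using \<open>0 < M\<close> by (intro add_increasing2) simp_all
      next
        case False
        then have "d\<^sup>2 \<le> (dist x (c z))\<^sup>2"
          using \<open>0 < d\<close> by (intro power_mono) (auto simp: dist_commute)
        moreover have "(dist x (c z0))\<^sup>2 \<le> (d / 2)\<^sup>2"
          using z0 by (intro power_mono) auto
        ultimately have "3 * d\<^sup>2 / 4 \<le> (dist x (c z))\<^sup>2 - (dist x (c z0))\<^sup>2"
          by (simp add: power_divide)
        then have "3 * d\<^sup>2 / 4 / (2 * s) \<le> ((dist x (c z))\<^sup>2 - (dist x (c z0))\<^sup>2) / (2 * s)"
          using \<open>0 < s\<close> by (intro divide_right_mono) auto
        moreover have "3 * d\<^sup>2 / 4 / (2 * s) = r"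
          using \<open>0 < d\<close> \<open>0 < r\<close> by (simp add: s_def field_simps)
        ultimately have "- (dist x (c z))\<^sup>2 / (2 * s) \<le> - r + - (dist x (c z0))\<^sup>2 / (2 * s)"
          by (simp add: diff_divide_distrib)
        then have "e z \<le> exp (- r) * e z0"
          by (simp add: e_def flip: exp_add)
        \<comment> \<open>The normaliser is bounded below by its single term at the nearby centre
          \<open>c z0\<close>.\<close>
        also have "\<dots> \<le> exp (- r) * T"
          unfolding T_def using z0 e0 by (intro mult_left_mono member_le_sum) (auto simp: less_imp_le)
        finally have "e z / T \<le> exp (- r)"
          using \<open>0 < T\<close> by (simp add: divide_simps)
        moreover have "norm (v (c z) - v x) \<le> 2 * M"
          using norm_triangle_ineq4[of "v (c z)" "v x"] M[OF cz] M[OF x] by linarith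
        ultimately have "e z / T * norm (v (c z) - v x) \<le> exp (- r) * (2 * M)"
          by (intro mult_mono) auto
        moreover have "0 < e z / T * (\<eta> / 2)"
          using pos \<open>0 < \<eta>\<close> by (intro mult_pos_pos) simp_all
        ultimately show ?thesis unfolding norm_eq by linarith
      qed
    qed
    have "(\<Sum>z=1..n. (e z / T) *\<^sub>R v (c z)) - v x
        = (\<Sum>z=1..n. (e z / T) *\<^sub>R v (c z)) - (\<Sum>z=1..n. e z / T) *\<^sub>R v x"
      by (simp only: one scaleR_one)
    also have "\<dots> = (\<Sum>z=1..n. (e z / T) *\<^sub>R (v (c z) - v x))"
      by (simp add: scaleR_diff_right sum_subtractf scaleR_sum_left)
    finally have "norm ((\<Sum>z=1..n. (e z / T) *\<^sub>R v (c z)) - v x)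
        \<le> (\<Sum>z=1..n. e z / T * (\<eta> / 2) + exp (- r) * (2 * M))"
      by (simp only: sum_norm_le bound)
    also have "\<dots> = \<eta> / 2 + exp (- r) * (2 * n * M)"
      by (simp only: sum.distrib one flip: sum_distrib_right) simp
    also have "\<dots> < \<eta>" using r by linarith
    finally show "norm ((\<Sum>z=1..n. (exp (- (dist x (c z))\<^sup>2 / (2 * s)) /
                         (\<Sum>\<zeta>=1..n. exp (- (dist x (c \<zeta>))\<^sup>2 / (2 * s)))) *\<^sub>R v (c z)) - v x) < \<eta>"
      by (simp only: e_def T_def)
  qed
qed

lemma matrix_inv_scaleR_mat_1:
  fixes s :: real
  assumes "s \<noteq> 0"
  shows "matrix_inv (s *\<^sub>R mat 1 :: real^'n^'n) = (1 / s) *\<^sub>R mat 1"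
proof -
  let ?A = "s *\<^sub>R mat 1 :: real^'n^'n"
  \<comment> \<open>\<open>matrix_inv\<close> is a Hilbert choice, so an explicit two-sided inverse
    is exhibited before its defining property can be used.\<close>
  have "?A ** ((1 / s) *\<^sub>R mat 1) = mat 1 \<and> ((1 / s) *\<^sub>R mat 1) ** ?A = mat 1"
    using assms by (simp add: matrix_scalar_ac)
  then have "?A ** matrix_inv ?A = mat 1"
    unfolding matrix_inv_def by (rule someI2) simp
  then have "s *\<^sub>R matrix_inv ?A = mat 1"
    by (simp flip: scalar_matrix_assoc)
  then have "(1 / s) *\<^sub>R s *\<^sub>R matrix_inv ?A = (1 / s) *\<^sub>R mat 1" by simp
  then show ?thesis using assms by simp
qed

lemma sym_pos_def_scaleR_mat_1:
  assumes "0 < s"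
  shows "sym_pos_def (s *\<^sub>R mat 1)"
  using assms by (simp add: sym_pos_def_def transpose_scalar scaleR_matrix_vector_assoc[symmetric])

text \<open>Allows the Gaussian prefactor to be cancelled: \<open>powr\<close> vanishes only at base
  0.\<close>

lemma det_scaleR_mat_1_nonzero:
  fixes s :: real
  assumes "s \<noteq> 0"
  shows "det (s *\<^sub>R mat 1 :: real^'n^'n) \<noteq> 0"
  using assms by (subst det_diagonal) (simp_all add: mat_def)

lemma gauss_density_isotropic:
  fixes x \<mu> :: "real^'p"
  assumes "0 < s"
  shows "gauss_density x \<mu> (s *\<^sub>R mat 1) =
    det ((2 * pi * s) *\<^sub>R mat 1 :: real^'p^'p) powr (- 1 / 2) * exp (- (dist x \<mu>)\<^sup>2 / (2 * s))"
  using assms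
  by (simp add: gauss_density_def matrix_inv_scaleR_mat_1 dist_norm power2_norm_eq_inner
      scaleR_matrix_vector_assoc[symmetric])

text \<open>With equal weights and a common covariance, all gates share one nonzero factor, which
  cancels between numerator and denominator.\<close>

lemma moe_mean_isotropic:
  fixes c :: "nat \<Rightarrow> real^'p" and a :: "nat \<Rightarrow> real^'q"
  assumes "0 < s" "1 \<le> n"
  shows "moe_mean n (\<lambda>_. 1 / n) c (\<lambda>_. s *\<^sub>R mat 1) a (\<lambda>_. 0) x =
    (\<Sum>z=1..n. (exp (- (dist x (c z))\<^sup>2 / (2 * s)) /
                (\<Sum>\<zeta>=1..n. exp (- (dist x (c \<zeta>))\<^sup>2 / (2 * s)))) *\<^sub>R a z)"
proof -
  define k where "k = 1 / n * det ((2 * pi * s) *\<^sub>R mat 1 :: real^'p^'p) powr (- 1 / 2)"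
  have "k \<noteq> 0"
    using assms det_scaleR_mat_1_nonzero[of "2 * pi * s", where 'n='p] by (simp add: k_def)
  have "1 / n * gauss_density x (c z) (s *\<^sub>R mat 1) = k * exp (- (dist x (c z))\<^sup>2 / (2 * s))" for z
    using assms by (simp add: gauss_density_isotropic k_def)
  moreover have "transpose (0 :: real^'q^'p) *v x = 0"
    by (simp add: transpose_def matrix_vector_mult_def vec_eq_iff)
  ultimately show ?thesis
    using \<open>k \<noteq> 0\<close> by (simp only: moe_mean_def flip: sum_distrib_left) simp
qed

lemma MoE_star_subset_MoE: "MoE_star X \<subseteq> MoE X"
  unfolding MoE_star_def MoE_def by blast

text \<open>Each coordinate is bounded by the Euclidean norm, and there are \<open>CARD('q)\<close>
  of them. An empty \<open>X\<close> is covered, as its suprema in \<open>ennreal\<close> are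
  0.\<close>

lemma sup_norm_le:
  fixes u :: "real^'p \<Rightarrow> real^'q" and b :: real
  assumes "0 \<le> b" "\<And>x. x \<in> X \<Longrightarrow> norm (u x) \<le> b"
  shows "sup_norm X u \<le> ennreal (CARD('q) * b)"
proof -
  have "(SUP x\<in>X. ennreal \<bar>u x $ j\<bar>) \<le> ennreal b" for j
    using assms by (intro SUP_least ennreal_leI order_trans[OF component_le_norm_cart]) auto
  then have "sup_norm X u \<le> (\<Sum>j\<in>(UNIV :: 'q set). ennreal b)"
    unfolding sup_norm_def by (intro sum_mono)
  then show ?thesis
    using \<open>0 \<le> b\<close> by (simp add: ennreal_mult ennreal_of_nat_eq_real_of_nat)
qed

lemma MoE_star_dense:
  fixes X :: "(real^'p) set" and v :: "real^'p \<Rightarrow> real^'q"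
  assumes "compact X" "v \<in> Cq X" "0 < \<epsilon>"
  shows "\<exists>m \<in> MoE_star X. sup_norm X (\<lambda>x. m x - v x) < ennreal \<epsilon>"
proof -
  \<comment> \<open>Summing over the coordinates gives \<open>\<epsilon> / 2\<close>; the factor 2
    restores strictness, since pointwise bounds yield only \<le> for a supremum.\<close>
  define b where "b = \<epsilon> / (2 * CARD('q))"
  have "0 < b" using \<open>0 < \<epsilon>\<close> by (simp add: b_def)
  have "\<exists>m \<in> MoE_star X. \<forall>x\<in>X. norm (m x - v x) \<le> b"
  proof (cases "X = {}")
    case True
    \<comment> \<open>On empty \<open>X\<close> membership in \<open>MoE_star X\<close> says nothing
      about values, so any admissible gate, here a single one, makes \<open>v\<close> itself a
      member.\<close>
    have "gate_params 1 (\<lambda>_. 1) (\<lambda>_. 1 *\<^sub>R mat 1 :: real^'p^'p)"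
      by (simp only: gate_params_def sym_pos_def_scaleR_mat_1 zero_less_one) simp
    then have "v \<in> MoE_star X"
      using True unfolding MoE_star_def by blast
    then show ?thesis using True by blast
  next
    case False
    \<comment> \<open>\<open>Cq\<close> gives continuity coordinate by coordinate; reassembling the
      vector gives it for \<open>v\<close>.\<close>
    have "continuous_on X (\<lambda>x. \<chi> j. v x $ j)"
      using \<open>v \<in> Cq X\<close> by (intro continuous_on_vec_lambda) (simp add: Cq_def)
    then have "continuous_on X v" by simp
    then obtain n :: nat and s :: real and c :: "nat \<Rightarrow> real^'p" where n: "1 \<le> n" and s: "0 < s"
      and approx: "\<forall>x\<in>X.
       norm ((\<Sum>z=1..n. (exp (- (dist x (c z))\<^sup>2 / (2 * s)) /
                         (\<Sum>\<zeta>=1..n. exp (- (dist x (c \<zeta>))\<^sup>2 / (2 * s)))) *\<^sub>R v (c z)) - v x) < b"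
      by (rule softmax_gaussian_approximation[OF \<open>compact X\<close> False _ \<open>0 < b\<close>])
    let ?m = "moe_mean n (\<lambda>_. 1 / n) c (\<lambda>_. s *\<^sub>R mat 1) (\<lambda>z. v (c z)) (\<lambda>_. 0)"
    have "gate_params n (\<lambda>_. 1 / n) (\<lambda>_. s *\<^sub>R mat 1 :: real^'p^'p)"
      using n s by (simp add: gate_params_def sym_pos_def_scaleR_mat_1)
    then have "?m \<in> MoE_star X"
      unfolding MoE_star_def by (intro CollectI exI conjI ballI) simp_all
    moreover have "norm (?m x - v x) \<le> b" if "x \<in> X" for x
      unfolding moe_mean_isotropic[OF s n] using approx that by (simp only: less_imp_le)
    ultimately show ?thesis by blast
  qed
  then obtain m where "m \<in> MoE_star X" and m: "\<And>x. x \<in> X \<Longrightarrow> norm (m x - v x) \<le> b"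
    by blast
  have "sup_norm X (\<lambda>x. m x - v x) \<le> ennreal (CARD('q) * b)"
    using sup_norm_le[of b X "\<lambda>x. m x - v x"] m \<open>0 < b\<close> by simp
  also have "\<dots> < ennreal \<epsilon>"
    using \<open>0 < \<epsilon>\<close> by (simp add: b_def ennreal_less_iff)
  finally show ?thesis using \<open>m \<in> MoE_star X\<close> by blast
qed

theorem theorem4:
  fixes X :: "(real^'p) set"
  assumes "compact X"
  shows "(\<forall>v \<in> (Cq X :: (real^'p \<Rightarrow> real^'q) set). \<forall>\<epsilon>::real. \<epsilon> > 0 \<longrightarrow>
            (\<exists>m \<in> MoE_star X. sup_norm X (\<lambda>x. m x - v x) < ennreal \<epsilon>))
       \<and> (\<forall>v \<in> (Cq X :: (real^'p \<Rightarrow> real^'q) set). \<forall>\<epsilon>::real. \<epsilon> > 0 \<longrightarrow>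
            (\<exists>m \<in> MoE X. sup_norm X (\<lambda>x. m x - v x) < ennreal \<epsilon>))"
  using MoE_star_dense[OF assms] MoE_star_subset_MoE by blast

end
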